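(* Let $\mathbb{T}$ be a quasi-equational theory over a signature $\Sigma$ and let $\mathcal{J}$ be a small category. Let $\mathbb{T}^{\mathcal{J}}$ be the associated quasi-equational theory over the signature $\Sigma^{\mathcal{J}}$ (defined in the context). Then there is an isomorphism of categories $\mathbb{T}^{\mathcal{J}}\mathsf{mod}\cong\mathbb{T}\mathsf{mod}^{\mathcal{J}}$, where $\mathbb{T}\mathsf{mod}^{\mathcal{J}}$ is the category of functors $\mathcal{J}\to\mathbb{T}\mathsf{mod}$ and natural transformations.
   Context: A signature $\Sigma$ has a set $\Sigma_{\mathsf{Sort}}$ of sorts and a set $\Sigma_{\mathsf{Fun}}$ of function symbols $f:A_1\times\dots\times A_n\to A$ ($n\ge0$). Terms are built as usual from sorted variables and function symbols; Horn formulas are finite conjunctions (including $\top$) of equations between terms of the same sort; $t\downarrow$ abbreviates $t=t$. A Horn sequent is $\varphi\vdash^{\vec x}\psi$ with $\varphi,\psi$ Horn formulas whose free variables lie in the finite list $\vec x$. A quasi-equational theory is a set of Horn sequents. A partial $\Sigma$-structure $M$ has a set $M_A$ for each sort and a partial function $f^M:M_{A_1}\times\dots\times M_{A_n}\rightharpoondown M_A$ for each function symbol; terms are interpreted as partial functions (defined where all subterms are), an equation holds at a tuple iff both sides are defined and equal, and $M$ satisfies $\varphi\vdash^{\vec x}\psi$ iff every tuple satisfying $\varphi$ satisfies $\psi$. $M$ is a model of a theory if it satisfies all its axioms. A $\Sigma$-morphism $h:M\to N$ is a family of total functions $h_A:M_A\to N_A$ such that $\vec a\in\mathsf{dom}(f^M)$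 implies $h(\vec a)\in\mathsf{dom}(f^N)$ and $h(f^M(\vec a))=f^N(h(\vec a))$. $\mathbb{T}\mathsf{mod}$ is the category of models of $\mathbb{T}$ and $\Sigma$-morphisms. The signature $\Sigma^{\mathcal{J}}$ has sorts $A^i$ ($A\in\Sigma_{\mathsf{Sort}}$, $i\in\mathrm{ob}\,\mathcal{J}$), function symbols $\alpha_f^A:A^i\to A^j$ for each morphism $f:i\to j$ of $\mathcal{J}$ and each sort $A$ of $\Sigma$, and $g^i:A_1^i\times\dots\times A_n^i\to A^i$ for each $g:A_1\times\dots\times A_n\to A$ in $\Sigma$ and $i\in\mathrm{ob}\,\mathcal{J}$. The theory $\mathbb{T}^{\mathcal{J}}$ has the axioms: 1. $\top\vdash^{x:A^i}\alpha_f^A(x)\downarrow$ for each $f:i\to j$ in $\mathcal{J}$ and sort $A$; 2. $\top\vdash^{x:A^i}\alpha^A_{\mathsf{id}_i}(x)=x$; 3. $\top\vdash^{x:A^i}\alpha_g^A(\alpha_f^A(x))=\alpha^A_{g\circ f}(x)$ for $f:i\to j$, $g:j\to k$; 4. $g^i(x_1,\dots,x_n)\downarrow\ \vdash^{x_1:A_1^i,\dots,x_n:A_n^i}\alpha_f^A(g^i(x_1,\dots,x_n))=g^j(\alpha_f^{A_1}(x_1),\dots,\alpha_f^{A_n}(x_n))$ for $f:i\to j$ in $\mathcal{J}$ and $g:A_1\times\dots\times A_n\to A$ in $\Sigma$; 5. for each $i\in\mathrm{ob}\,\mathcal{J}$ and each axiom $\varphi\vdash^{\vec x}\psi$ of $\mathbb{T}$,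 its translation obtained by replacing each sort $A$ by $A^i$ and each function symbol $g$ by $g^i$. *)

theory Defs
  imports Main "HOL-Library.FuncSet"
begin

section \<open>Categories, functors and natural transformations\<close>

text \<open>\<open>Comp C g f\<close> is the composite of \<open>f\<close> followed by \<open>g\<close>; its value is only
  meaningful on composable arrows.\<close>

record ('o, 'm) cat =
  Obj :: "'o set"
  Arr :: "'m set"
  Dom :: "'m \<Rightarrow> 'o"
  Cod :: "'m \<Rightarrow> 'o"
  Id :: "'o \<Rightarrow> 'm"
  Comp :: "'m \<Rightarrow> 'm \<Rightarrow> 'm"

definition hom :: "('o, 'm) cat \<Rightarrow> 'o \<Rightarrow> 'o \<Rightarrow> 'm set" where
  "hom C a b = {f \<in> Arr C. Dom C f = a \<and> Cod C f = b}"

locale category =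
  fixes C :: "('o, 'm) cat"
  assumes dom_obj: "f \<in> Arr C \<Longrightarrow> Dom C f \<in> Obj C"
    and cod_obj: "f \<in> Arr C \<Longrightarrow> Cod C f \<in> Obj C"
    and id_hom: "a \<in> Obj C \<Longrightarrow> Id C a \<in> hom C a a"
    and comp_hom: "f \<in> hom C a b \<Longrightarrow> g \<in> hom C b c \<Longrightarrow> Comp C g f \<in> hom C a c"
    and comp_id_left: "f \<in> hom C a b \<Longrightarrow> Comp C (Id C b) f = f"
    and comp_id_right: "f \<in> hom C a b \<Longrightarrow> Comp C f (Id C a) = f"
    and comp_assoc: "f \<in> hom C a b \<Longrightarrow> g \<in> hom C b c \<Longrightarrow> h \<in> hom C c d
        \<Longrightarrow> Comp C h (Comp C g f) = Comp C (Comp C h g) f"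

text \<open>The object and arrow maps of a functor are extensional functions (constantly
  \<open>undefined\<close> off \<open>Obj C\<close> and \<open>Arr C\<close>), so that HOL equality of functors is the
  mathematical one.\<close>

record ('o1, 'm1, 'o2, 'm2) functr =
  omap :: "'o1 \<Rightarrow> 'o2"
  amap :: "'m1 \<Rightarrow> 'm2"

definition is_functor ::
  "('o1, 'm1) cat \<Rightarrow> ('o2, 'm2) cat \<Rightarrow> ('o1, 'm1, 'o2, 'm2) functr \<Rightarrow> bool" where
  "is_functor C D F \<longleftrightarrow>
     category C \<and> category D \<and>
     omap F \<in> Obj C \<rightarrow>\<^sub>E Obj D \<and>
     amap F \<in> Arr C \<rightarrow>\<^sub>E Arr D \<and>
     (\<forall>f\<in>Arr C. amap F f \<in> hom D (omap F (Dom C f)) (omap F (Cod C f))) \<and>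
     (\<forall>a\<in>Obj C. amap F (Id C a) = Id D (omap F a)) \<and>
     (\<forall>f\<in>Arr C. \<forall>g\<in>Arr C. Cod C f = Dom C g \<longrightarrow>
        amap F (Comp C g f) = Comp D (amap F g) (amap F f))"

definition id_functor :: "('o, 'm) cat \<Rightarrow> ('o, 'm, 'o, 'm) functr" where
  "id_functor C = \<lparr>omap = (\<lambda>a\<in>Obj C. a), amap = (\<lambda>f\<in>Arr C. f)\<rparr>"

text \<open>\<open>comp_functor C G F\<close> is the composite of \<open>F\<close> followed by \<open>G\<close>, where \<open>C\<close> is the domain of \<open>F\<close>.\<close>

definition comp_functor ::
  "('o1, 'm1) cat \<Rightarrow> ('o2, 'm2, 'o3, 'm3) functr \<Rightarrow> ('o1, 'm1, 'o2, 'm2) functr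
    \<Rightarrow> ('o1, 'm1, 'o3, 'm3) functr" where
  "comp_functor C G F =
     \<lparr>omap = compose (Obj C) (omap G) (omap F), amap = compose (Arr C) (amap G) (amap F)\<rparr>"

definition isomorphic_categories :: "('o1, 'm1) cat \<Rightarrow> ('o2, 'm2) cat \<Rightarrow> bool" where
  "isomorphic_categories C D \<longleftrightarrow>
     (\<exists>F G. is_functor C D F \<and> is_functor D C G \<and>
            comp_functor C G F = id_functor C \<and> comp_functor D F G = id_functor D)"

text \<open>Arrows tagged with their source and target, used where the underlying data of a
  morphism does not determine its domain and codomain.\<close>

datatype ('a, 'h) arrow = Arrow (src: 'a) (mor: 'h) (tgt: 'a)

definition natural_transformation ::
  "('o1, 'm1) cat \<Rightarrow> ('o2, 'm2) cat \<Rightarrow> ('o1, 'm1, 'o2, 'm2) functr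
    \<Rightarrow> ('o1, 'm1, 'o2, 'm2) functr \<Rightarrow> ('o1 \<Rightarrow> 'm2) \<Rightarrow> bool" where
  "natural_transformation C D F G \<eta> \<longleftrightarrow>
     is_functor C D F \<and> is_functor C D G \<and>
     \<eta> \<in> (\<Pi>\<^sub>E a\<in>Obj C. hom D (omap F a) (omap G a)) \<and>
     (\<forall>f\<in>Arr C. Comp D (amap G f) (\<eta> (Dom C f)) = Comp D (\<eta> (Cod C f)) (amap F f))"

definition functor_category ::
  "('o1, 'm1) cat \<Rightarrow> ('o2, 'm2) cat
    \<Rightarrow> (('o1, 'm1, 'o2, 'm2) functr, (('o1, 'm1, 'o2, 'm2) functr, 'o1 \<Rightarrow> 'm2) arrow) cat" where
  "functor_category C D =
     \<lparr>Obj = {F. is_functor C D F},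
      Arr = {Arrow F \<eta> G | F \<eta> G. natural_transformation C D F G \<eta>},
      Dom = src,
      Cod = tgt,
      Id = (\<lambda>F. Arrow F (\<lambda>a\<in>Obj C. Id D (omap F a)) F),
      Comp = (\<lambda>\<theta> \<eta>. Arrow (src \<eta>) (\<lambda>a\<in>Obj C. Comp D (mor \<theta> a) (mor \<eta> a)) (tgt \<theta>))\<rparr>"


section \<open>Signatures, terms and quasi-equational theories\<close>

record ('s, 'f) signature =
  Sorts :: "'s set"
  Funs :: "'f set"
  arity :: "'f \<Rightarrow> 's list"
  result :: "'f \<Rightarrow> 's"

definition is_signature :: "('s, 'f) signature \<Rightarrow> bool" where
  "is_signature \<Sigma> \<longleftrightarrow>
     (\<forall>f\<in>Funs \<Sigma>. set (arity \<Sigma> f) \<subseteq> Sorts \<Sigma> \<and> result \<Sigma> f \<in> Sorts \<Sigma>)"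

text \<open>A sorted variable is a pair of a name and a sort; there are countably many of each sort.\<close>

type_synonym 's var = "nat \<times> 's"

datatype (vars: 'v, syms: 'f) trm = Var 'v | App 'f "('v, 'f) trm list"

inductive has_sort :: "('s, 'f) signature \<Rightarrow> ('s var, 'f) trm \<Rightarrow> 's \<Rightarrow> bool"
  for \<Sigma> :: "('s, 'f) signature" where
  "A \<in> Sorts \<Sigma> \<Longrightarrow> has_sort \<Sigma> (Var (n, A)) A"
| "f \<in> Funs \<Sigma> \<Longrightarrow> list_all2 (has_sort \<Sigma>) ts (arity \<Sigma> f) \<Longrightarrow> has_sort \<Sigma> (App f ts) (result \<Sigma> f)"

text \<open>A Horn formula is the list of its conjuncts, each an equation; \<open>[]\<close> is truth.\<close>

type_synonym ('s, 'f) horn = "(('s var, 'f) trm \<times> ('s var, 'f) trm) list"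

abbreviation defined :: "('s var, 'f) trm \<Rightarrow> ('s, 'f) horn" where
  "defined t \<equiv> [(t, t)]"

datatype ('s, 'f) sequent =
  Sequent (ctxt: "'s var list") (hyp: "('s, 'f) horn") (concl: "('s, 'f) horn")

definition is_horn :: "('s, 'f) signature \<Rightarrow> 's var list \<Rightarrow> ('s, 'f) horn \<Rightarrow> bool" where
  "is_horn \<Sigma> xs \<phi> \<longleftrightarrow>
     (\<forall>(t, u)\<in>set \<phi>. (\<exists>A. has_sort \<Sigma> t A \<and> has_sort \<Sigma> u A) \<and> vars t \<union> vars u \<subseteq> set xs)"

definition is_sequent :: "('s, 'f) signature \<Rightarrow> ('s, 'f) sequent \<Rightarrow> bool" where
  "is_sequent \<Sigma> \<sigma> \<longleftrightarrow>
     distinct (ctxt \<sigma>) \<and> snd ` set (ctxt \<sigma>) \<subseteq> Sorts \<Sigma> \<and>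
     is_horn \<Sigma> (ctxt \<sigma>) (hyp \<sigma>) \<and> is_horn \<Sigma> (ctxt \<sigma>) (concl \<sigma>)"

definition is_theory :: "('s, 'f) signature \<Rightarrow> ('s, 'f) sequent set \<Rightarrow> bool" where
  "is_theory \<Sigma> T \<longleftrightarrow> (\<forall>\<sigma>\<in>T. is_sequent \<Sigma> \<sigma>)"


section \<open>Partial structures and models\<close>

text \<open>The type \<open>'u\<close> is the universe of elements: carriers are sets over \<open>'u\<close>. Carriers of
  non-sorts are empty and non-symbols are nowhere defined, so that HOL equality of structures
  is the mathematical one.\<close>

record ('s, 'f, 'u) pstruct =
  carrier :: "'s \<Rightarrow> 'u set"
  interp :: "'f \<Rightarrow> 'u list \<Rightarrow> 'u option"

definition is_structure :: "('s, 'f) signature \<Rightarrow> ('s, 'f, 'u) pstruct \<Rightarrow> bool" where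
  "is_structure \<Sigma> M \<longleftrightarrow>
     (\<forall>A. A \<notin> Sorts \<Sigma> \<longrightarrow> carrier M A = {}) \<and>
     (\<forall>f as b. interp M f as = Some b \<longrightarrow>
        f \<in> Funs \<Sigma> \<and> list_all2 (\<lambda>a A. a \<in> carrier M A) as (arity \<Sigma> f) \<and>
        b \<in> carrier M (result \<Sigma> f))"

text \<open>\<open>those\<close> yields \<open>None\<close> as soon as one of the arguments is undefined.\<close>

primrec eval_term :: "('s, 'f, 'u) pstruct \<Rightarrow> ('s var \<Rightarrow> 'u) \<Rightarrow> ('s var, 'f) trm \<Rightarrow> 'u option" where
  "eval_term M \<rho> (Var x) = Some (\<rho> x)"
| "eval_term M \<rho> (App f ts) = Option.bind (those (map (eval_term M \<rho>) ts)) (interp M f)"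

definition holds :: "('s, 'f, 'u) pstruct \<Rightarrow> ('s var \<Rightarrow> 'u) \<Rightarrow> ('s, 'f) horn \<Rightarrow> bool" where
  "holds M \<rho> \<phi> \<longleftrightarrow>
     (\<forall>(t, u)\<in>set \<phi>. \<exists>a. eval_term M \<rho> t = Some a \<and> eval_term M \<rho> u = Some a)"

text \<open>A tuple for the context is given by an assignment that is constrained on the variables of
  the context only; its other values are irrelevant.\<close>

definition satisfies :: "('s, 'f, 'u) pstruct \<Rightarrow> ('s, 'f) sequent \<Rightarrow> bool" where
  "satisfies M \<sigma> \<longleftrightarrow>
     (\<forall>\<rho>. (\<forall>x\<in>set (ctxt \<sigma>). \<rho> x \<in> carrier M (snd x)) \<longrightarrow>
        holds M \<rho> (hyp \<sigma>) \<longrightarrow> holds M \<rho> (concl \<sigma>))"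

definition is_model ::
  "('s, 'f) signature \<Rightarrow> ('s, 'f) sequent set \<Rightarrow> ('s, 'f, 'u) pstruct \<Rightarrow> bool" where
  "is_model \<Sigma> T M \<longleftrightarrow> is_structure \<Sigma> M \<and> (\<forall>\<sigma>\<in>T. satisfies M \<sigma>)"

definition is_morphism ::
  "('s, 'f) signature \<Rightarrow> ('s, 'f, 'u) pstruct \<Rightarrow> ('s, 'f, 'u) pstruct
    \<Rightarrow> ('s \<Rightarrow> 'u \<Rightarrow> 'u) \<Rightarrow> bool" where
  "is_morphism \<Sigma> M N h \<longleftrightarrow>
     (\<forall>A. h A \<in> carrier M A \<rightarrow>\<^sub>E carrier N A) \<and>
     (\<forall>f\<in>Funs \<Sigma>. \<forall>as b. interp M f as = Some b \<longrightarrow>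
        interp N f (map2 h (arity \<Sigma> f) as) = Some (h (result \<Sigma> f) b))"

definition Mod ::
  "('s, 'f) signature \<Rightarrow> ('s, 'f) sequent set
    \<Rightarrow> (('s, 'f, 'u) pstruct, (('s, 'f, 'u) pstruct, 's \<Rightarrow> 'u \<Rightarrow> 'u) arrow) cat" where
  "Mod \<Sigma> T =
     \<lparr>Obj = {M. is_model \<Sigma> T M},
      Arr = {Arrow M h N | M h N. is_model \<Sigma> T M \<and> is_model \<Sigma> T N \<and> is_morphism \<Sigma> M N h},
      Dom = src,
      Cod = tgt,
      Id = (\<lambda>M. Arrow M (\<lambda>A. \<lambda>a\<in>carrier M A. a) M),
      Comp = (\<lambda>k h. Arrow (src h) (\<lambda>A. compose (carrier (src h) A) (mor k A) (mor h A)) (tgt k))\<rparr>"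


section \<open>The theory of diagrams of models\<close>

text \<open>The sort \<open>(A, i)\<close> is \<open>A\<^sup>i\<close>; \<open>Alpha f A\<close> is the transition map of the arrow \<open>f\<close> at the
  sort \<open>A\<close>, and \<open>Lift g i\<close> is \<open>g\<^sup>i\<close>.\<close>

datatype ('s, 'f, 'o, 'm) diag_sym = Alpha 'm 's | Lift 'f 'o

definition diag_sig ::
  "('s, 'f) signature \<Rightarrow> ('o, 'm) cat \<Rightarrow> ('s \<times> 'o, ('s, 'f, 'o, 'm) diag_sym) signature" where
  "diag_sig \<Sigma> J =
     \<lparr>Sorts = Sorts \<Sigma> \<times> Obj J,
      Funs = {Alpha f A | f A. f \<in> Arr J \<and> A \<in> Sorts \<Sigma>} \<union> {Lift g i | g i. g \<in> Funs \<Sigma> \<and> i \<in> Obj J},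
      arity = (\<lambda>s. case s of Alpha f A \<Rightarrow> [(A, Dom J f)]
                           | Lift g i \<Rightarrow> map (\<lambda>A. (A, i)) (arity \<Sigma> g)),
      result = (\<lambda>s. case s of Alpha f A \<Rightarrow> (A, Cod J f)
                            | Lift g i \<Rightarrow> (result \<Sigma> g, i))\<rparr>"

definition lift_var :: "'o \<Rightarrow> 's var \<Rightarrow> ('s \<times> 'o) var" where
  "lift_var i x = (fst x, (snd x, i))"

definition lift_term ::
  "'o \<Rightarrow> ('s var, 'f) trm \<Rightarrow> (('s \<times> 'o) var, ('s, 'f, 'o, 'm) diag_sym) trm" where
  "lift_term i = map_trm (lift_var i) (\<lambda>g. Lift g i)"

definition lift_horn ::
  "'o \<Rightarrow> ('s, 'f) horn \<Rightarrow> ('s \<times> 'o, ('s, 'f, 'o, 'm) diag_sym) horn" where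
  "lift_horn i = map (map_prod (lift_term i) (lift_term i))"

definition lift_sequent ::
  "'o \<Rightarrow> ('s, 'f) sequent \<Rightarrow> ('s \<times> 'o, ('s, 'f, 'o, 'm) diag_sym) sequent" where
  "lift_sequent i \<sigma> =
     Sequent (map (lift_var i) (ctxt \<sigma>)) (lift_horn i (hyp \<sigma>)) (lift_horn i (concl \<sigma>))"

text \<open>The variables \<open>x\<^sub>1 : A\<^sub>1\<^sup>i, \<dots>, x\<^sub>n : A\<^sub>n\<^sup>i\<close> for the argument sorts \<open>A\<^sub>1, \<dots>, A\<^sub>n\<close> of \<open>g\<close>.\<close>

definition arg_vars :: "('s, 'f) signature \<Rightarrow> 'f \<Rightarrow> 'o \<Rightarrow> ('s \<times> 'o) var list" where
  "arg_vars \<Sigma> g i = map (\<lambda>k. (k, (arity \<Sigma> g ! k, i))) [0..<length (arity \<Sigma> g)]"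

definition alpha_total ::
  "('o, 'm) cat \<Rightarrow> 'm \<Rightarrow> 's \<Rightarrow> ('s \<times> 'o, ('s, 'f, 'o, 'm) diag_sym) sequent" where
  "alpha_total J f A =
     (let x = (0, (A, Dom J f)) in Sequent [x] [] (defined (App (Alpha f A) [Var x])))"

definition alpha_id ::
  "('o, 'm) cat \<Rightarrow> 'o \<Rightarrow> 's \<Rightarrow> ('s \<times> 'o, ('s, 'f, 'o, 'm) diag_sym) sequent" where
  "alpha_id J i A =
     (let x = (0, (A, i)) in Sequent [x] [] [(App (Alpha (Id J i) A) [Var x], Var x)])"

definition alpha_comp ::
  "('o, 'm) cat \<Rightarrow> 'm \<Rightarrow> 'm \<Rightarrow> 's \<Rightarrow> ('s \<times> 'o, ('s, 'f, 'o, 'm) diag_sym) sequent" where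
  "alpha_comp J g f A =
     (let x = (0, (A, Dom J f)) in
      Sequent [x] []
        [(App (Alpha g A) [App (Alpha f A) [Var x]], App (Alpha (Comp J g f) A) [Var x])])"

definition alpha_natural ::
  "('s, 'f) signature \<Rightarrow> ('o, 'm) cat \<Rightarrow> 'm \<Rightarrow> 'f
    \<Rightarrow> ('s \<times> 'o, ('s, 'f, 'o, 'm) diag_sym) sequent" where
  "alpha_natural \<Sigma> J f g =
     (let xs = arg_vars \<Sigma> g (Dom J f); t = App (Lift g (Dom J f)) (map Var xs) in
      Sequent xs (defined t)
        [(App (Alpha f (result \<Sigma> g)) [t],
          App (Lift g (Cod J f)) (map2 (\<lambda>A x. App (Alpha f A) [Var x]) (arity \<Sigma> g) xs))])"

definition diag_theory ::
  "('s, 'f) signature \<Rightarrow> ('s, 'f) sequent set \<Rightarrow> ('o, 'm) cat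
    \<Rightarrow> ('s \<times> 'o, ('s, 'f, 'o, 'm) diag_sym) sequent set" where
  "diag_theory \<Sigma> T J =
     {alpha_total J f A | f A. f \<in> Arr J \<and> A \<in> Sorts \<Sigma>} \<union>
     {alpha_id J i A | i A. i \<in> Obj J \<and> A \<in> Sorts \<Sigma>} \<union>
     {alpha_comp J g f A | g f A. f \<in> Arr J \<and> g \<in> Arr J \<and> Cod J f = Dom J g \<and> A \<in> Sorts \<Sigma>} \<union>
     {alpha_natural \<Sigma> J f g | f g. f \<in> Arr J \<and> g \<in> Funs \<Sigma>} \<union>
     {lift_sequent i \<sigma> | i \<sigma>. i \<in> Obj J \<and> \<sigma> \<in> T}"

end

(* A model of the diagram theory is cut along the objects i of J into fibres, which are models
   of T because a lifted sequent holds in M exactly when the original one holds in the fibre.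
   The axioms on the symbols Alpha f A say precisely that these are total, functorial in f, and
   morphisms between fibres; preservation of Alpha f A by a morphism is naturality. Both
   passages only regroup data, so they are strictly mutually inverse. *)

theory Submission
  imports Defs
begin

text \<open>The isomorphism is strict, so equations between structures, functors and families of
  maps have to hold on the nose, default values included. Hence every map is restricted to its
  carrier, carriers at non-sorts are empty, and undefinedness outside the signature is part of being
  a structure. This emptiness also lets laws be stated for all indices \<open>A\<close>, although
  the axioms range over sorts only. The sort \<open>(A, i)\<close> and the sort \<open>A\<close> of
  the fibre at \<open>i\<close> have the same carrier, so both sides live over one universe
  \<open>'u\<close>. Since \<open>Alpha f A\<close> is a partial operation, it yields a transition
  map only once totality is known; the other axioms are translated under that condition. The
  definedness hypothesis of the naturality axiom matches the fact that a morphism of partial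
  structures preserves definedness but need not reflect it. Functoriality is checked only for the
  passage from diagram models to functors; the inverse inherits it from bijectivity on objects and
  arrows.\<close>

section \<open>Isomorphisms of categories\<close>

text \<open>A functor that is injective on arrows reflects equations between them: two arrows of
  \<open>C\<close> with the same image under \<open>F\<close> are equal. This gives the laws of
  identities and composites for the inverse maps; sources and targets are recovered in the same way
  from the object map.\<close>

lemma isomorphic_categories_if_bij:
  assumes F: "is_functor C D F"
    and obj: "bij_betw (omap F) (Obj C) (Obj D)"
    and arr: "bij_betw (amap F) (Arr C) (Arr D)"
  shows "isomorphic_categories C D"
proof -
  interpret C: category C using F by (simp add: is_functor_def)
  interpret D: category D using F by (simp add: is_functor_def)
  define G where "G = \<lparr>omap = (\<lambda>b\<in>Obj D. inv_into (Obj C) (omap F) b),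
    amap = (\<lambda>g\<in>Arr D. inv_into (Arr C) (amap F) g)\<rparr>"
  have Fo: "omap F a \<in> Obj D" if "a \<in> Obj C" for a
    using F that by (auto simp: is_functor_def)
  have Fa: "amap F f \<in> hom D (omap F (Dom C f)) (omap F (Cod C f))" if "f \<in> Arr C" for f
    using F that by (auto simp: is_functor_def)
  have GFo: "omap G (omap F a) = a" if "a \<in> Obj C" for a
    using that Fo[OF that] obj by (simp add: G_def bij_betw_inv_into_left)
  have GFa: "amap G (amap F f) = f" if "f \<in> Arr C" for f
    using that Fa[OF that] arr by (simp add: G_def hom_def bij_betw_inv_into_left)
  have FGo: "omap F (omap G b) = b" if "b \<in> Obj D" for b
    using that obj by (simp add: G_def bij_betw_inv_into_right)
  have FGa: "amap F (amap G g) = g" if "g \<in> Arr D" for g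
    using that arr by (simp add: G_def bij_betw_inv_into_right)
  have Go: "omap G b \<in> Obj C" if "b \<in> Obj D" for b
    using that obj by (simp add: G_def bij_betw_def inv_into_into)
  have Ga: "amap G g \<in> Arr C" if "g \<in> Arr D" for g
    using that arr by (simp add: G_def bij_betw_def inv_into_into)
  have Gdom: "Dom C (amap G g) = omap G (Dom D g)" and Gcod: "Cod C (amap G g) = omap G (Cod D g)"
    if "g \<in> Arr D" for g
  proof -
    have "g \<in> hom D (omap F (Dom C (amap G g))) (omap F (Cod C (amap G g)))"
      using Fa[OF Ga[OF that]] FGa[OF that] by simp
    then show "Dom C (amap G g) = omap G (Dom D g)" "Cod C (amap G g) = omap G (Cod D g)"
      using GFo C.dom_obj C.cod_obj Ga[OF that] by (auto simp: hom_def)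
  qed
  have "amap G (Id D b) = Id C (omap G b)" if b: "b \<in> Obj D" for b
  proof -
    have "Id C (omap G b) \<in> Arr C"
      using C.id_hom[OF Go[OF b]] by (simp add: hom_def)
    moreover have "amap F (Id C (omap G b)) = Id D b"
      using F Go[OF b] FGo[OF b] by (simp add: is_functor_def)
    ultimately show ?thesis using GFa by metis
  qed
  moreover have "amap G (Comp D g f) = Comp C (amap G g) (amap G f)"
    if f: "f \<in> Arr D" and g: "g \<in> Arr D" and fg: "Cod D f = Dom D g" for f g
  proof -
    have eq: "Cod C (amap G f) = Dom C (amap G g)"
      using Gdom[OF g] Gcod[OF f] fg by simp
    then have "Comp C (amap G g) (amap G f) \<in> Arr C"
      using C.comp_hom[of "amap G f" _ _ "amap G g"] Ga[OF f] Ga[OF g] by (auto simp: hom_def)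
    moreover have "amap F (Comp C (amap G g) (amap G f)) = Comp D g f"
      using F Ga[OF f] Ga[OF g] FGa[OF f] FGa[OF g] eq by (simp add: is_functor_def)
    ultimately show ?thesis using GFa by metis
  qed
  moreover have "omap G \<in> Obj D \<rightarrow>\<^sub>E Obj C" "amap G \<in> Arr D \<rightarrow>\<^sub>E Arr C"
    using Go Ga by (auto simp: G_def)
  ultimately have "is_functor D C G"
    unfolding is_functor_def hom_def
    using C.category_axioms D.category_axioms Ga Gdom Gcod by simp
  moreover have "comp_functor C G F = id_functor C"
    using GFo GFa by (auto simp: comp_functor_def id_functor_def compose_def)
  moreover have "comp_functor D F G = id_functor D"
    using FGo FGa by (auto simp: comp_functor_def id_functor_def compose_def)
  ultimately show ?thesis using F unfolding isomorphic_categories_def by blast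
qed

section \<open>Categories of models and functor categories\<close>

lemma structure_interp:
  assumes "is_structure \<Sigma> M" "interp M f as = Some b"
  shows "f \<in> Funs \<Sigma>" "list_all2 (\<lambda>a A. a \<in> carrier M A) as (arity \<Sigma> f)"
    "b \<in> carrier M (result \<Sigma> f)"
  using assms by (auto simp: is_structure_def)

text \<open>The identity family is \<open>undefined\<close> off the carriers, so it fixes only
  well-sorted tuples. That suffices, because in a structure an operation is defined only at such
  tuples.\<close>

lemma morphism_id:
  assumes "is_structure \<Sigma> M"
  shows "is_morphism \<Sigma> M M (\<lambda>A. \<lambda>a\<in>carrier M A. a)"
proof -
  have "map2 (\<lambda>A. \<lambda>a\<in>carrier M A. a) Bs as = as"
    if "list_all2 (\<lambda>a A. a \<in> carrier M A) as Bs" for as Bs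
    using that by (induction rule: list_all2_induct) auto
  then show ?thesis
    using structure_interp[OF assms] by (auto simp: is_morphism_def)
qed

lemma morphism_compose:
  assumes M: "is_structure \<Sigma> M"
    and h: "is_morphism \<Sigma> M N h" and k: "is_morphism \<Sigma> N P k"
  shows "is_morphism \<Sigma> M P (\<lambda>A. compose (carrier M A) (k A) (h A))"
proof -
  \<comment> \<open>\<open>compose\<close> is cut off outside \<open>carrier M A\<close>, so
    applying the composite agrees with applying the two maps in turn only on well-sorted tuples;
    definedness of \<open>f\<close> supplies the sorting below.\<close>
  have map2: "map2 (\<lambda>A. compose (carrier M A) (k A) (h A)) Bs as = map2 k Bs (map2 h Bs as)"
    if "list_all2 (\<lambda>a A. a \<in> carrier M A) as Bs" for as Bs
    using that by (induction rule: list_all2_induct) (auto simp: compose_def)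
  have "compose (carrier M A) (k A) (h A) \<in> carrier M A \<rightarrow>\<^sub>E carrier P A" for A
  proof -
    have "h A \<in> carrier M A \<rightarrow>\<^sub>E carrier N A" "k A \<in> carrier N A \<rightarrow>\<^sub>E carrier P A"
      using h k by (auto simp: is_morphism_def)
    then show ?thesis by (auto simp: compose_def)
  qed
  moreover have "interp P f (map2 (\<lambda>A. compose (carrier M A) (k A) (h A)) (arity \<Sigma> f) as)
      = Some (compose (carrier M (result \<Sigma> f)) (k (result \<Sigma> f)) (h (result \<Sigma> f)) b)"
    if f: "f \<in> Funs \<Sigma>" and b: "interp M f as = Some b" for f as b
  proof -
    have "interp N f (map2 h (arity \<Sigma> f) as) = Some (h (result \<Sigma> f) b)"
      using h f b by (simp add: is_morphism_def)
    then have "interp P f (map2 k (arity \<Sigma> f) (map2 h (arity \<Sigma> f) as))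
        = Some (k (result \<Sigma> f) (h (result \<Sigma> f) b))"
      using k f unfolding is_morphism_def by blast
    then show ?thesis
      using map2 structure_interp[OF M b] by (simp add: compose_def)
  qed
  ultimately show ?thesis by (simp add: is_morphism_def)
qed

lemma category_Mod: "category (Mod \<Sigma> T)"
proof
  fix a assume "a \<in> Obj (Mod \<Sigma> T)"
  then show "Id (Mod \<Sigma> T) a \<in> hom (Mod \<Sigma> T) a a"
    using morphism_id by (auto simp: Mod_def hom_def is_model_def)
next
  fix f g a b c assume "f \<in> hom (Mod \<Sigma> T) a b" "g \<in> hom (Mod \<Sigma> T) b c"
  then show "Comp (Mod \<Sigma> T) g f \<in> hom (Mod \<Sigma> T) a c"
    using morphism_compose by (fastforce simp: Mod_def hom_def is_model_def)
next
  fix f a b assume f: "f \<in> hom (Mod \<Sigma> T) a b"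
  then have "is_morphism \<Sigma> a b (mor f)"
    by (auto simp: Mod_def hom_def)
  then have ext: "mor f A \<in> carrier a A \<rightarrow>\<^sub>E carrier b A" for A
    by (simp add: is_morphism_def)
  \<comment> \<open>The unit laws are equations of total HOL functions; off the carrier both sides
    are \<open>undefined\<close> because components of morphisms are extensional.\<close>
  have "compose (carrier a A) (\<lambda>x\<in>carrier b A. x) (mor f A) = mor f A" for A
    using ext[of A] by (auto simp: compose_def fun_eq_iff PiE_def extensional_def)
  then show "Comp (Mod \<Sigma> T) (Id (Mod \<Sigma> T) b) f = f"
    using f by (auto simp: Mod_def hom_def)
  have "compose (carrier a A) (mor f A) (\<lambda>x\<in>carrier a A. x) = mor f A" for A
    using ext[of A] by (auto simp: compose_def fun_eq_iff PiE_def extensional_def)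
  then show "Comp (Mod \<Sigma> T) f (Id (Mod \<Sigma> T) a) = f"
    using f by (auto simp: Mod_def hom_def)
next
  fix f g h a b c d
  assume "f \<in> hom (Mod \<Sigma> T) a b" "g \<in> hom (Mod \<Sigma> T) b c" "h \<in> hom (Mod \<Sigma> T) c d"
  moreover from this have "is_morphism \<Sigma> a b (mor f)"
    by (auto simp: Mod_def hom_def)
  \<comment> \<open>Reassociating restricted composites needs the innermost map to land in the set
    to which the composite of the outer two is restricted.\<close>
  then have "mor f A \<in> carrier a A \<rightarrow> carrier b A" for A
    by (auto simp: is_morphism_def PiE_def)
  ultimately show "Comp (Mod \<Sigma> T) h (Comp (Mod \<Sigma> T) g f)
      = Comp (Mod \<Sigma> T) (Comp (Mod \<Sigma> T) h g) f"
    by (auto simp: Mod_def hom_def intro!: ext compose_assoc)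
qed (auto simp: Mod_def)

section \<open>Functors and natural transformations form a category\<close>

lemma natural_transformation_id:
  assumes F: "is_functor C D F"
  shows "natural_transformation C D F F (\<lambda>a\<in>Obj C. Id D (omap F a))"
proof -
  interpret C: category C using F by (simp add: is_functor_def)
  interpret D: category D using F by (simp add: is_functor_def)
  have "omap F a \<in> Obj D" if "a \<in> Obj C" for a
    using F that by (auto simp: is_functor_def)
  moreover have "Comp D (amap F f) (Id D (omap F (Dom C f)))
      = Comp D (Id D (omap F (Cod C f))) (amap F f)" if "f \<in> Arr C" for f
    using F that D.comp_id_left D.comp_id_right unfolding is_functor_def by metis
  ultimately show ?thesis
    using F D.id_hom C.dom_obj C.cod_obj by (auto simp: natural_transformation_def)
qed

text \<open>Pasting of two naturality squares: the square of \<open>\<theta>\<close> is used at the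
  source of \<open>f\<close>, the square of \<open>\<eta>\<close> at its target, and associativity
  moves between them.\<close>

lemma natural_transformation_comp:
  assumes \<eta>: "natural_transformation C D F G \<eta>" and \<theta>: "natural_transformation C D G H \<theta>"
  shows "natural_transformation C D F H (\<lambda>a\<in>Obj C. Comp D (\<theta> a) (\<eta> a))"
proof -
  have F: "is_functor C D F" and G: "is_functor C D G" and H: "is_functor C D H"
    using \<eta> \<theta> by (auto simp: natural_transformation_def)
  interpret C: category C using F by (simp add: is_functor_def)
  interpret D: category D using F by (simp add: is_functor_def)
  have \<eta>_hom: "\<eta> a \<in> hom D (omap F a) (omap G a)" if "a \<in> Obj C" for a
    using \<eta> that by (auto simp: natural_transformation_def)
  have \<theta>_hom: "\<theta> a \<in> hom D (omap G a) (omap H a)" if "a \<in> Obj C" for a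
    using \<theta> that by (auto simp: natural_transformation_def)
  have "Comp D (amap H f) (Comp D (\<theta> (Dom C f)) (\<eta> (Dom C f)))
      = Comp D (Comp D (\<theta> (Cod C f)) (\<eta> (Cod C f))) (amap F f)" if f: "f \<in> Arr C" for f
  proof -
    note dom = C.dom_obj[OF f] and cod = C.cod_obj[OF f]
    have Ff: "amap F f \<in> hom D (omap F (Dom C f)) (omap F (Cod C f))"
      and Gf: "amap G f \<in> hom D (omap G (Dom C f)) (omap G (Cod C f))"
      and Hf: "amap H f \<in> hom D (omap H (Dom C f)) (omap H (Cod C f))"
      using F G H f by (auto simp: is_functor_def)
    have "Comp D (amap H f) (Comp D (\<theta> (Dom C f)) (\<eta> (Dom C f)))
        = Comp D (Comp D (amap H f) (\<theta> (Dom C f))) (\<eta> (Dom C f))"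
      using D.comp_assoc \<eta>_hom[OF dom] \<theta>_hom[OF dom] Hf by blast
    also have "\<dots> = Comp D (Comp D (\<theta> (Cod C f)) (amap G f)) (\<eta> (Dom C f))"
      using \<theta> f by (simp add: natural_transformation_def)
    also have "\<dots> = Comp D (\<theta> (Cod C f)) (Comp D (amap G f) (\<eta> (Dom C f)))"
      using D.comp_assoc \<eta>_hom[OF dom] \<theta>_hom[OF cod] Gf by metis
    also have "\<dots> = Comp D (\<theta> (Cod C f)) (Comp D (\<eta> (Cod C f)) (amap F f))"
      using \<eta> f by (simp add: natural_transformation_def)
    also have "\<dots> = Comp D (Comp D (\<theta> (Cod C f)) (\<eta> (Cod C f))) (amap F f)"
      using D.comp_assoc \<eta>_hom[OF cod] \<theta>_hom[OF cod] Ff by metis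
    finally show ?thesis .
  qed
  then show ?thesis
    using F H D.comp_hom[OF \<eta>_hom \<theta>_hom] C.dom_obj C.cod_obj
    by (auto simp: natural_transformation_def)
qed

lemma category_functor_category:
  assumes "category C" "category D"
  shows "category (functor_category C D)"
proof -
  interpret D: category D by fact
  have homE: "\<exists>\<eta>. f = Arrow F \<eta> G \<and> natural_transformation C D F G \<eta>"
    if "f \<in> hom (functor_category C D) F G" for f F G
    using that by (auto simp: functor_category_def hom_def)
  have component: "\<eta> a \<in> hom D (omap F a) (omap G a)"
    if "natural_transformation C D F G \<eta>" "a \<in> Obj C" for F G \<eta> a
    using that by (auto simp: natural_transformation_def)
  have extensional: "\<eta> \<in> extensional (Obj C)" if "natural_transformation C D F G \<eta>" for F G \<eta>
    using that by (auto simp: natural_transformation_def PiE_def)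
  show ?thesis
  proof
    fix F assume "F \<in> Obj (functor_category C D)"
    then show "Id (functor_category C D) F \<in> hom (functor_category C D) F F"
      using natural_transformation_id by (auto simp: functor_category_def hom_def)
  next
    fix f g F G H
    assume "f \<in> hom (functor_category C D) F G" "g \<in> hom (functor_category C D) G H"
    then show "Comp (functor_category C D) g f \<in> hom (functor_category C D) F H"
      using natural_transformation_comp by (fastforce simp: functor_category_def hom_def)
  next
    fix f F G assume "f \<in> hom (functor_category C D) F G"
    then obtain \<eta> where f: "f = Arrow F \<eta> G" and \<eta>: "natural_transformation C D F G \<eta>"
      using homE by blast
    show "Comp (functor_category C D) (Id (functor_category C D) G) f = f"
      using D.comp_id_left[OF component[OF \<eta>]]
      by (auto simp: functor_category_def f intro!: extensionalityI[OF _ extensional[OF \<eta>]])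
    show "Comp (functor_category C D) f (Id (functor_category C D) F) = f"
      using D.comp_id_right[OF component[OF \<eta>]]
      by (auto simp: functor_category_def f intro!: extensionalityI[OF _ extensional[OF \<eta>]])
  next
    fix f g h F G H K
    assume "f \<in> hom (functor_category C D) F G" "g \<in> hom (functor_category C D) G H"
      "h \<in> hom (functor_category C D) H K"
    then obtain \<eta> \<theta> \<kappa> where fgh: "f = Arrow F \<eta> G" "g = Arrow G \<theta> H" "h = Arrow H \<kappa> K"
      and \<eta>: "natural_transformation C D F G \<eta>" and \<theta>: "natural_transformation C D G H \<theta>"
      and \<kappa>: "natural_transformation C D H K \<kappa>"
      using homE by metis
    show "Comp (functor_category C D) h (Comp (functor_category C D) g f)
        = Comp (functor_category C D) (Comp (functor_category C D) h g) f"
      using D.comp_assoc[OF component[OF \<eta>] component[OF \<theta>] component[OF \<kappa>]]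
      by (auto simp: functor_category_def fgh)
  qed (auto simp: functor_category_def natural_transformation_def)
qed

section \<open>Models of the theory of diagrams\<close>

definition fibre ::
  "('s \<times> 'o, ('s, 'f, 'o, 'm) diag_sym, 'u) pstruct \<Rightarrow> 'o \<Rightarrow> ('s, 'f, 'u) pstruct" where
  "fibre M i = \<lparr>carrier = (\<lambda>A. carrier M (A, i)), interp = (\<lambda>g. interp M (Lift g i))\<rparr>"

text \<open>The value taken by \<open>the\<close> is meaningful only where the operation is defined,
  so totality has to accompany its use. The restriction makes each component extensional, as arrows
  of \<open>Mod\<close> require.\<close>

definition transition ::
  "('o, 'm) cat \<Rightarrow> ('s \<times> 'o, ('s, 'f, 'o, 'm) diag_sym, 'u) pstruct \<Rightarrow> 'm \<Rightarrow> 's \<Rightarrow> 'u \<Rightarrow> 'u" where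
  "transition J M f A = (\<lambda>a\<in>carrier M (A, Dom J f). the (interp M (Alpha f A) [a]))"

lemma fibre_simps [simp]:
  "carrier (fibre M i) A = carrier M (A, i)" "interp (fibre M i) g = interp M (Lift g i)"
  by (simp_all add: fibre_def)

section \<open>Truth of lifted sequents\<close>

lemma lift_term_App: "lift_term i (App g ts) = App (Lift g i) (map (lift_term i) ts)"
  by (simp add: lift_term_def)

text \<open>Tagging the symbols by \<open>i\<close> is undone by the definition of the fibre, and
  tagging the variables is absorbed into the assignment.\<close>

lemma eval_lift_term: "eval_term M \<rho> (lift_term i t) = eval_term (fibre M i) (\<rho> \<circ> lift_var i) t"
proof (induction t)
  case (App g ts)
  then have "map (eval_term M \<rho>) (map (lift_term i) ts)
      = map (eval_term (fibre M i) (\<rho> \<circ> lift_var i)) ts"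
    by (simp add: comp_def)
  then show ?case by (simp only: lift_term_App eval_term.simps fibre_simps)
qed (simp add: lift_term_def)

lemma holds_lift_horn: "holds M \<rho> (lift_horn i \<phi>) \<longleftrightarrow> holds (fibre M i) (\<rho> \<circ> lift_var i) \<phi>"
  by (auto simp: holds_def lift_horn_def eval_lift_term split: prod.splits)

lemma satisfies_lift_sequent: "satisfies M (lift_sequent i \<sigma>) \<longleftrightarrow> satisfies (fibre M i) \<sigma>"
proof -
  \<comment> \<open>Needed to pass from the assignments of the form
    \<open>\<rho> \<circ> lift_var i\<close> to all assignments. As \<open>lift_var i\<close> is
    injective, an extension exists; the witness simply forgets the tag of a variable.\<close>
  have surj: "\<exists>\<rho>. \<rho>' = \<rho> \<circ> lift_var i" for \<rho>' :: "'a var \<Rightarrow> 'e"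
    by (rule exI[of _ "\<lambda>(n, A, j). \<rho>' (n, A)"]) (auto simp: lift_var_def)
  have "satisfies M (lift_sequent i \<sigma>) \<longleftrightarrow>
      (\<forall>\<rho>. (\<forall>x\<in>set (ctxt \<sigma>). (\<rho> \<circ> lift_var i) x \<in> carrier (fibre M i) (snd x)) \<longrightarrow>
        holds (fibre M i) (\<rho> \<circ> lift_var i) (hyp \<sigma>) \<longrightarrow>
        holds (fibre M i) (\<rho> \<circ> lift_var i) (concl \<sigma>))"
    by (simp add: satisfies_def lift_sequent_def holds_lift_horn) (simp add: lift_var_def)
  also have "\<dots> \<longleftrightarrow> satisfies (fibre M i) \<sigma>"
    unfolding satisfies_def using surj by metis
  finally show ?thesis .
qed

section \<open>Element-wise meaning of the axioms on transition symbols\<close>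

lemma all_assignments: "(\<forall>\<rho>. P (\<rho> x)) \<longleftrightarrow> (\<forall>a. P a)"
  \<comment> \<open>A prescribed value \<open>a\<close> is attained by the constant
    assignment.\<close>
  by (auto dest: spec[of _ "\<lambda>_. _"])

lemma eval_term_unary:
  "eval_term M \<rho> (App f [t]) = Option.bind (eval_term M \<rho> t) (\<lambda>a. interp M f [a])"
  by (cases "eval_term M \<rho> t") auto

lemma satisfies_alpha_total:
  "satisfies M (alpha_total J f A) \<longleftrightarrow>
    (\<forall>a\<in>carrier M (A, Dom J f). interp M (Alpha f A) [a] = Some (transition J M f A a))"
  using all_assignments[of "\<lambda>a. a \<in> carrier M (A, Dom J f) \<longrightarrow>
      (\<exists>b. interp M (Alpha f A) [a] = Some b)" "(0, A, Dom J f)"]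
  by (auto simp: satisfies_def alpha_total_def holds_def transition_def Let_def)

lemma satisfies_alpha_id:
  "satisfies M (alpha_id J i A) \<longleftrightarrow>
    (\<forall>a\<in>carrier M (A, i). interp M (Alpha (Id J i) A) [a] = Some a)"
  using all_assignments[of "\<lambda>a. a \<in> carrier M (A, i) \<longrightarrow>
      interp M (Alpha (Id J i) A) [a] = Some a" "(0, A, i)"]
  by (auto simp: satisfies_def alpha_id_def holds_def Let_def)

lemma satisfies_alpha_comp:
  "satisfies M (alpha_comp J g f A) \<longleftrightarrow>
    (\<forall>a\<in>carrier M (A, Dom J f). \<exists>b c. interp M (Alpha f A) [a] = Some b \<and>
      interp M (Alpha g A) [b] = Some c \<and> interp M (Alpha (Comp J g f) A) [a] = Some c)"
  using all_assignments[of "\<lambda>a. a \<in> carrier M (A, Dom J f) \<longrightarrow>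
      (\<exists>c. (\<exists>b. interp M (Alpha f A) [a] = Some b \<and> interp M (Alpha g A) [b] = Some c) \<and>
        interp M (Alpha (Comp J g f) A) [a] = Some c)" "(0, A, Dom J f)"]
  by (simp add: satisfies_def alpha_comp_def holds_def Let_def eval_term_unary bind_eq_Some_conv
      del: eval_term.simps(2)) blast

lemma those_map_Some: "those (map (\<lambda>x. Some (f x)) xs) = Some (map f xs)"
  by (induction xs) auto

text \<open>Totality turns the terms built with \<open>Alpha f A\<close> into values of genuine
  maps, so the axiom becomes preservation of \<open>g\<close>. Totality is asked at the result sort
  too, since one side of the equation applies the transition map to the value of
  \<open>g\<close>.\<close>

lemma satisfies_alpha_natural:
  assumes M: "is_structure (diag_sig \<Sigma> J) M"
    and total: "\<And>A a. A \<in> set (result \<Sigma> g # arity \<Sigma> g) \<Longrightarrow> a \<in> carrier M (A, Dom J f) \<Longrightarrow>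
      interp M (Alpha f A) [a] = Some (transition J M f A a)"
  shows "satisfies M (alpha_natural \<Sigma> J f g) \<longleftrightarrow>
    (\<forall>as b. interp M (Lift g (Dom J f)) as = Some b \<longrightarrow>
      interp M (Lift g (Cod J f)) (map2 (transition J M f) (arity \<Sigma> g) as)
        = Some (transition J M f (result \<Sigma> g) b))" (is "_ \<longleftrightarrow> (\<forall>as b. ?nat as b)")
proof -
  let ?i = "Dom J f" and ?n = "length (arity \<Sigma> g)"
  let ?xs = "arg_vars \<Sigma> g ?i"
  let ?as = "\<lambda>\<rho>. map \<rho> ?xs"
  define typed where "typed as \<longleftrightarrow> list_all2 (\<lambda>a A. a \<in> carrier M (A, ?i)) as (arity \<Sigma> g)" for as
  have in_ctxt: "(\<forall>x\<in>set ?xs. \<rho> x \<in> carrier M (snd x)) \<longleftrightarrow> typed (?as \<rho>)" for \<rho>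
    by (auto simp: typed_def list_all2_conv_all_nth arg_vars_def)
  have typed_interp: "typed as" "b \<in> carrier M (result \<Sigma> g, ?i)"
    if "interp M (Lift g ?i) as = Some b" for as b
    using structure_interp[OF M that]
    by (auto simp: diag_sig_def typed_def list_all2_map2)
  have all_as: "(\<forall>\<rho>. typed (?as \<rho>) \<longrightarrow> P (?as \<rho>)) \<longleftrightarrow> (\<forall>as. typed as \<longrightarrow> P as)" for P
  proof -
    have "\<exists>\<rho>. as = ?as \<rho>" if "typed as" for as
    \<comment> \<open>\<open>arg_vars\<close> numbers its variables by argument position, so reading
      that number as an index into \<open>as\<close> recovers the tuple, even when sorts
      repeat.\<close>
    proof (rule exI[of _ "\<lambda>(k, _). as ! k"])
      have "length as = ?n" using that by (auto simp: typed_def dest: list_all2_lengthD)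
      then show "as = ?as (\<lambda>(k, _). as ! k)"
        by (auto simp: arg_vars_def comp_def intro!: nth_equalityI)
    qed
    then show ?thesis by blast
  qed
  have eval_t: "eval_term M \<rho> (App (Lift g ?i) (map Var ?xs)) = interp M (Lift g ?i) (?as \<rho>)" for \<rho>
    by (simp add: comp_def those_map_Some)
  \<comment> \<open>By totality every argument \<open>Alpha f A\<close> is defined, so
    \<open>those\<close> succeeds; the outer application may still be undefined, and the equation is
    one between options.\<close>
  have eval_u: "eval_term M \<rho> (App (Lift g (Cod J f))
        (map2 (\<lambda>A x. App (Alpha f A) [Var x]) (arity \<Sigma> g) ?xs))
      = interp M (Lift g (Cod J f)) (map2 (transition J M f) (arity \<Sigma> g) (?as \<rho>))"
    if "typed (?as \<rho>)" for \<rho>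
  proof -
    have "map (eval_term M \<rho>) (map2 (\<lambda>A x. App (Alpha f A) [Var x]) (arity \<Sigma> g) ?xs)
        = map (\<lambda>(A, a). Some (transition J M f A a)) (zip (arity \<Sigma> g) (?as \<rho>))"
      using that total by (intro nth_equalityI) (auto simp: typed_def list_all2_conv_all_nth)
    then have "those (map (eval_term M \<rho>)
        (map2 (\<lambda>A x. App (Alpha f A) [Var x]) (arity \<Sigma> g) ?xs))
        = Some (map2 (transition J M f) (arity \<Sigma> g) (?as \<rho>))"
      by (simp add: case_prod_beta' those_map_Some)
    then show ?thesis by simp
  qed
  have "satisfies M (alpha_natural \<Sigma> J f g) \<longleftrightarrow>
      (\<forall>\<rho>. typed (?as \<rho>) \<longrightarrow> (\<forall>b. ?nat (?as \<rho>) b))"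
    unfolding satisfies_def alpha_natural_def Let_def
    using total typed_interp
    by (auto simp: in_ctxt holds_def eval_t eval_u eval_term_unary bind_eq_Some_conv
        simp del: eval_term.simps(2))
  also have "\<dots> \<longleftrightarrow> (\<forall>as b. ?nat as b)"
    \<comment> \<open>The sorting condition disappears because a defined application has well-sorted
      arguments.\<close>
    unfolding all_as[of "\<lambda>as. \<forall>b. ?nat as b"] using typed_interp by blast
  finally show ?thesis .
qed

section \<open>Diagram models described by fibres and transition maps\<close>

lemma in_carrier_diag:
  assumes "is_structure (diag_sig \<Sigma> J) M" "a \<in> carrier M (A, i)"
  shows "A \<in> Sorts \<Sigma>" "i \<in> Obj J"
  using assms by (auto simp: is_structure_def diag_sig_def)

lemma structure_fibre:
  assumes "is_structure (diag_sig \<Sigma> J) M"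
  shows "is_structure \<Sigma> (fibre M i)"
  using structure_interp[OF assms, of "Lift _ i"] in_carrier_diag[OF assms]
  by (fastforce simp: is_structure_def diag_sig_def list_all2_map2)

text \<open>The hinge between syntax and semantics: all later work uses \<open>fibre\<close> and
  \<open>transition\<close> and never returns to the axioms. Quantifying over every \<open>A\<close>
  is harmless, since an element of \<open>carrier M (A, i)\<close> forces \<open>A\<close> to be a
  sort.\<close>

lemma diag_model_iff:
  assumes "category J"
  shows "is_model (diag_sig \<Sigma> J) (diag_theory \<Sigma> T J) M \<longleftrightarrow>
    is_structure (diag_sig \<Sigma> J) M \<and>
    (\<forall>i\<in>Obj J. \<forall>\<sigma>\<in>T. satisfies (fibre M i) \<sigma>) \<and>
    (\<forall>f\<in>Arr J. \<forall>A. \<forall>a\<in>carrier M (A, Dom J f).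
      interp M (Alpha f A) [a] = Some (transition J M f A a)) \<and>
    (\<forall>i\<in>Obj J. \<forall>A. \<forall>a\<in>carrier M (A, i). transition J M (Id J i) A a = a) \<and>
    (\<forall>f\<in>Arr J. \<forall>g\<in>Arr J. Cod J f = Dom J g \<longrightarrow> (\<forall>A. \<forall>a\<in>carrier M (A, Dom J f).
      transition J M (Comp J g f) A a = transition J M g A (transition J M f A a))) \<and>
    (\<forall>f\<in>Arr J. is_morphism \<Sigma> (fibre M (Dom J f)) (fibre M (Cod J f)) (transition J M f))"
  (is "_ \<longleftrightarrow> _ \<and> ?fib \<and> ?total \<and> ?id \<and> ?comp \<and> ?nat")
proof (cases "is_structure (diag_sig \<Sigma> J) M")
  case M: True
  interpret J: category J by fact
  have theory_iff: "(\<forall>\<sigma>\<in>diag_theory \<Sigma> T J. satisfies M \<sigma>) \<longleftrightarrow>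
      (\<forall>i\<in>Obj J. \<forall>\<sigma>\<in>T. satisfies M (lift_sequent i \<sigma>)) \<and>
      (\<forall>f\<in>Arr J. \<forall>A\<in>Sorts \<Sigma>. satisfies M (alpha_total J f A)) \<and>
      (\<forall>i\<in>Obj J. \<forall>A\<in>Sorts \<Sigma>. satisfies M (alpha_id J i A)) \<and>
      (\<forall>f\<in>Arr J. \<forall>g\<in>Arr J. Cod J f = Dom J g \<longrightarrow>
        (\<forall>A\<in>Sorts \<Sigma>. satisfies M (alpha_comp J g f A))) \<and>
      (\<forall>f\<in>Arr J. \<forall>g\<in>Funs \<Sigma>. satisfies M (alpha_natural \<Sigma> J f g))"
    unfolding diag_theory_def by blast
  have total_iff: "(\<forall>f\<in>Arr J. \<forall>A\<in>Sorts \<Sigma>. satisfies M (alpha_total J f A)) \<longleftrightarrow> ?total"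
    using in_carrier_diag[OF M] by (auto simp: satisfies_alpha_total)
  show ?thesis
  \<comment> \<open>The identity, composition and naturality axioms match their counterparts for
    \<open>transition\<close> only if its values are genuine. If totality fails, both sides of the
    equivalence are false.\<close>
  proof (cases ?total)
    case total: True
    then have alpha: "interp M (Alpha f A) [a] = Some (transition J M f A a)"
      if "f \<in> Arr J" "a \<in> carrier M (A, Dom J f)" for f A a
      using that by blast
    have transition_in: "transition J M f A a \<in> carrier M (A, Cod J f)"
      if "f \<in> Arr J" "a \<in> carrier M (A, Dom J f)" for f A a
      using structure_interp(3)[OF M alpha[OF that]] by (simp add: diag_sig_def)
    have "satisfies M (alpha_id J i A) \<longleftrightarrow>
        (\<forall>a\<in>carrier M (A, i). transition J M (Id J i) A a = a)" if "i \<in> Obj J" for i A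
      using J.id_hom[OF that] alpha[of "Id J i"] by (auto simp: satisfies_alpha_id hom_def)
    then have id_iff: "(\<forall>i\<in>Obj J. \<forall>A\<in>Sorts \<Sigma>. satisfies M (alpha_id J i A)) \<longleftrightarrow> ?id"
      using in_carrier_diag(1)[OF M] by blast
    have "satisfies M (alpha_comp J g f A) \<longleftrightarrow> (\<forall>a\<in>carrier M (A, Dom J f).
        transition J M (Comp J g f) A a = transition J M g A (transition J M f A a))"
      if "f \<in> Arr J" "g \<in> Arr J" "Cod J f = Dom J g" for f g A
    proof -
      have "Comp J g f \<in> Arr J" "Dom J (Comp J g f) = Dom J f"
        using J.comp_hom[of f "Dom J f" "Cod J f" g "Cod J g"] that by (auto simp: hom_def)
      then show ?thesis
        using that alpha transition_in[of f] by (auto simp: satisfies_alpha_comp)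
    qed
    then have comp_iff: "(\<forall>f\<in>Arr J. \<forall>g\<in>Arr J. Cod J f = Dom J g \<longrightarrow>
        (\<forall>A\<in>Sorts \<Sigma>. satisfies M (alpha_comp J g f A))) \<longleftrightarrow> ?comp"
      using in_carrier_diag(1)[OF M] by blast
    have "(\<forall>g\<in>Funs \<Sigma>. satisfies M (alpha_natural \<Sigma> J f g)) \<longleftrightarrow>
        is_morphism \<Sigma> (fibre M (Dom J f)) (fibre M (Cod J f)) (transition J M f)"
      if f: "f \<in> Arr J" for f
    proof -
      have "transition J M f A \<in> carrier M (A, Dom J f) \<rightarrow>\<^sub>E carrier M (A, Cod J f)" for A
        using transition_in[OF f] by (auto simp: transition_def)
      then show ?thesis
        using satisfies_alpha_natural[OF M, where f = f] alpha[OF f] by (simp add: is_morphism_def)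
    qed
    then show ?thesis
      using M total theory_iff total_iff id_iff comp_iff
      by (simp add: is_model_def satisfies_lift_sequent)
  qed (use theory_iff total_iff in \<open>auto simp: is_model_def\<close>)
qed (simp add: is_model_def)

locale diagram_theory = J: category J
  for \<Sigma> :: "('s, 'f) signature" and T :: "('s, 'f) sequent set" and J :: "('o, 'm) cat"
begin

abbreviation diag_model ::
  "('s \<times> 'o, ('s, 'f, 'o, 'm) diag_sym, 'u) pstruct \<Rightarrow> bool" where
  "diag_model \<equiv> is_model (diag_sig \<Sigma> J) (diag_theory \<Sigma> T J)"

text \<open>The pointwise laws are restated as equations of whole families, the form in which
  \<open>Mod\<close> has its identities and composites. Off the carrier both sides are
  \<open>undefined\<close>, which uses that \<open>Id J i\<close> starts at \<open>i\<close> and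
  \<open>Comp J g f\<close> starts where \<open>f\<close> does.\<close>

lemma diag_model_facts:
  assumes "diag_model M"
  shows model_structure: "is_structure (diag_sig \<Sigma> J) M"
    and model_fibre: "i \<in> Obj J \<Longrightarrow> is_model \<Sigma> T (fibre M i)"
    and interp_alpha: "f \<in> Arr J \<Longrightarrow> a \<in> carrier M (A, Dom J f) \<Longrightarrow>
      interp M (Alpha f A) [a] = Some (transition J M f A a)"
    and transition_id: "i \<in> Obj J \<Longrightarrow> transition J M (Id J i) = (\<lambda>A. \<lambda>a\<in>carrier M (A, i). a)"
    and transition_comp: "f \<in> Arr J \<Longrightarrow> g \<in> Arr J \<Longrightarrow> Cod J f = Dom J g \<Longrightarrow>
      transition J M (Comp J g f)
        = (\<lambda>A. compose (carrier M (A, Dom J f)) (transition J M g A) (transition J M f A))"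
    and transition_morphism: "f \<in> Arr J \<Longrightarrow>
      is_morphism \<Sigma> (fibre M (Dom J f)) (fibre M (Cod J f)) (transition J M f)"
proof -
  note * = assms[unfolded diag_model_iff[OF J.category_axioms]]
  show "is_structure (diag_sig \<Sigma> J) M" using * by blast
  then show "is_model \<Sigma> T (fibre M i)" if "i \<in> Obj J"
    using * that structure_fibre by (auto simp: is_model_def)
  show "interp M (Alpha f A) [a] = Some (transition J M f A a)"
    if "f \<in> Arr J" "a \<in> carrier M (A, Dom J f)" using * that by blast
  show "transition J M (Id J i) = (\<lambda>A. \<lambda>a\<in>carrier M (A, i). a)" if "i \<in> Obj J"
  proof -
    have "Dom J (Id J i) = i" using J.id_hom[OF that] by (simp add: hom_def)
    then have "transition J M (Id J i) A a = (\<lambda>a\<in>carrier M (A, i). a) a" for A a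
      using * that by (cases "a \<in> carrier M (A, i)") (auto simp: transition_def)
    then show ?thesis by blast
  qed
  show "transition J M (Comp J g f)
      = (\<lambda>A. compose (carrier M (A, Dom J f)) (transition J M g A) (transition J M f A))"
    if "f \<in> Arr J" "g \<in> Arr J" "Cod J f = Dom J g"
  proof -
    have "Dom J (Comp J g f) = Dom J f"
      using J.comp_hom[of f "Dom J f" "Cod J f" g "Cod J g"] that by (auto simp: hom_def)
    moreover have "transition J M (Comp J g f) A a = transition J M g A (transition J M f A a)"
      if "a \<in> carrier M (A, Dom J f)" for A a
      using * \<open>f \<in> Arr J\<close> \<open>g \<in> Arr J\<close> \<open>Cod J f = Dom J g\<close> that by blast
    moreover have "transition J M (Comp J g f) A a = undefined"
      if "a \<notin> carrier M (A, Dom J (Comp J g f))" for A a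
      using that by (simp add: transition_def)
    ultimately show ?thesis by (simp add: compose_def restrict_def fun_eq_iff)
  qed
  show "is_morphism \<Sigma> (fibre M (Dom J f)) (fibre M (Cod J f)) (transition J M f)"
    if "f \<in> Arr J" using * that by blast
qed

text \<open>Preservation splits by symbol: \<open>Lift g i\<close> gives morphisms of fibres,
  \<open>Alpha f A\<close> gives the naturality squares. The first conjunct records the default: for
  a non-object \<open>i\<close> the carrier is empty, and the only extensional map on it is
  constantly \<open>undefined\<close>.\<close>

lemma diag_morphism_iff:
  assumes M: "diag_model M" and N: "diag_model N"
  shows "is_morphism (diag_sig \<Sigma> J) M N h \<longleftrightarrow>
    (\<forall>i. i \<notin> Obj J \<longrightarrow> (\<forall>A. h (A, i) = (\<lambda>_. undefined))) \<and>
    (\<forall>i\<in>Obj J. is_morphism \<Sigma> (fibre M i) (fibre N i) (\<lambda>A. h (A, i))) \<and>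
    (\<forall>f\<in>Arr J. \<forall>A. \<forall>a\<in>carrier M (A, Dom J f).
      transition J N f A (h (A, Dom J f) a) = h (A, Cod J f) (transition J M f A a))"
  (is "_ \<longleftrightarrow> ?ext \<and> ?mor \<and> ?square")
proof -
  note strM = model_structure[OF M] and strN = model_structure[OF N]
  \<comment> \<open>All argument sorts of \<open>Lift g i\<close> carry the same tag, so
    \<open>h\<close> acts on its arguments through the slice at \<open>i\<close>.\<close>
  have map2_lift: "map2 h (map (\<lambda>A. (A, i)) Bs) as = map2 (\<lambda>A. h (A, i)) Bs as" for i Bs as
    by (simp add: zip_map1 case_prod_beta')
  show ?thesis
  proof
    assume h: "is_morphism (diag_sig \<Sigma> J) M N h"
    have maps: "h A \<in> carrier M A \<rightarrow>\<^sub>E carrier N A" for A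
      using h unfolding is_morphism_def by blast
    have pres: "interp N f (map2 h (arity (diag_sig \<Sigma> J) f) as)
        = Some (h (result (diag_sig \<Sigma> J) f) b)" if "interp M f as = Some b" for f as b
      using h structure_interp(1)[OF strM that] that by (simp add: is_morphism_def)
    have ?ext
    proof (intro allI impI ext)
      fix i A a assume "i \<notin> Obj J"
      then have "a \<notin> carrier M (A, i)" using in_carrier_diag(2)[OF strM] by blast
      then show "h (A, i) a = undefined" using maps by blast
    qed
    moreover have ?mor
      using maps pres[of "Lift _ _"] map2_lift
      by (auto simp: is_morphism_def diag_sig_def)
    moreover have ?square
    proof (intro ballI allI)
      fix f A a assume f: "f \<in> Arr J" and a: "a \<in> carrier M (A, Dom J f)"
      then have "h (A, Dom J f) a \<in> carrier N (A, Dom J f)" using maps by blast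
      then show "transition J N f A (h (A, Dom J f) a) = h (A, Cod J f) (transition J M f A a)"
        using pres[OF interp_alpha[OF M f a]] interp_alpha[OF N f] by (simp add: diag_sig_def)
    qed
    ultimately show "?ext \<and> ?mor \<and> ?square" by blast
  next
    assume h: "?ext \<and> ?mor \<and> ?square"
    have maps: "h (A, i) \<in> carrier M (A, i) \<rightarrow>\<^sub>E carrier N (A, i)" for A i
    proof (cases "i \<in> Obj J")
      case True
      then show ?thesis using h by (simp add: is_morphism_def)
    next
      case False
      then have "carrier M (A, i) = {}" using in_carrier_diag(2)[OF strM] by blast
      then show ?thesis using h False by auto
    qed
    moreover have "interp N s (map2 h (arity (diag_sig \<Sigma> J) s) as)
        = Some (h (result (diag_sig \<Sigma> J) s) b)"
      if b: "interp M s as = Some b" for s as b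
    proof (cases s)
      case (Lift g i)
      then have "i \<in> Obj J" "g \<in> Funs \<Sigma>"
        using structure_interp(1)[OF strM b] by (auto simp: diag_sig_def)
      then show ?thesis
        using h b Lift map2_lift by (simp add: is_morphism_def diag_sig_def)
    next
      case (Alpha f A)
      then have f: "f \<in> Arr J"
        using structure_interp(1)[OF strM b] by (auto simp: diag_sig_def)
      obtain a where as: "as = [a]" and a: "a \<in> carrier M (A, Dom J f)"
        using structure_interp(2)[OF strM b] Alpha
        by (auto simp: diag_sig_def list_all2_Cons2)
      have "h (A, Dom J f) a \<in> carrier N (A, Dom J f)" using maps a by blast
      then show ?thesis
        using h b f a as Alpha interp_alpha[OF N f] interp_alpha[OF M f a]
        by (simp add: diag_sig_def)
    qed
    ultimately show "is_morphism (diag_sig \<Sigma> J) M N h" by (simp add: is_morphism_def)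
  qed
qed

subsection \<open>Diagram models as functors\<close>

definition to_functor where
  "to_functor M = \<lparr>omap = (\<lambda>i\<in>Obj J. fibre M i),
     amap = (\<lambda>f\<in>Arr J. Arrow (fibre M (Dom J f)) (transition J M f) (fibre M (Cod J f)))\<rparr>"

text \<open>The guards make this a structure in the strict sense. In particular
  \<open>Alpha f A\<close> is defined exactly at one-element tuples from the source carrier; without
  the guard the map in \<open>amap F f\<close> would contribute \<open>undefined\<close> as a value
  elsewhere.\<close>

definition of_functor where
  "of_functor F = \<lparr>carrier = (\<lambda>(A, i). if i \<in> Obj J then carrier (omap F i) A else {}),
     interp = (\<lambda>s as. case s of
         Lift g i \<Rightarrow> if i \<in> Obj J then interp (omap F i) g as else None
       | Alpha f A \<Rightarrow> if f \<in> Arr J \<and> (\<exists>a\<in>carrier (omap F (Dom J f)) A. as = [a])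
           then Some (mor (amap F f) A (hd as)) else None)\<rparr>"

lemma is_functor_to_functor:
  assumes M: "diag_model M"
  shows "is_functor J (Mod \<Sigma> T) (to_functor M)"
  unfolding is_functor_def
proof (intro conjI ballI impI)
  show "omap (to_functor M) \<in> Obj J \<rightarrow>\<^sub>E Obj (Mod \<Sigma> T)"
    using model_fibre[OF M] by (auto simp: to_functor_def Mod_def)
  have arr: "amap (to_functor M) f
      \<in> hom (Mod \<Sigma> T) (omap (to_functor M) (Dom J f)) (omap (to_functor M) (Cod J f))"
    if "f \<in> Arr J" for f
    using that model_fibre[OF M] transition_morphism[OF M] J.dom_obj J.cod_obj
    by (simp add: to_functor_def Mod_def hom_def)
  then show "amap (to_functor M) f
      \<in> hom (Mod \<Sigma> T) (omap (to_functor M) (Dom J f)) (omap (to_functor M) (Cod J f))"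
    if "f \<in> Arr J" for f
    using that .
  show "amap (to_functor M) \<in> Arr J \<rightarrow>\<^sub>E Arr (Mod \<Sigma> T)"
    using arr by (auto simp: hom_def) (simp add: to_functor_def)
  fix i assume "i \<in> Obj J"
  then show "amap (to_functor M) (Id J i) = Id (Mod \<Sigma> T) (omap (to_functor M) i)"
    using J.id_hom transition_id[OF M] by (simp add: to_functor_def Mod_def hom_def)
next
  fix f g assume fg: "f \<in> Arr J" "g \<in> Arr J" "Cod J f = Dom J g"
  then have "Comp J g f \<in> hom J (Dom J f) (Cod J g)"
    using J.comp_hom[of f "Dom J f" "Cod J f" g "Cod J g"] by (simp add: hom_def)
  then show "amap (to_functor M) (Comp J g f)
      = Comp (Mod \<Sigma> T) (amap (to_functor M) g) (amap (to_functor M) f)"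
    using fg transition_comp[OF M fg] by (simp add: to_functor_def Mod_def hom_def)
qed (simp_all add: J.category_axioms category_Mod)

text \<open>Arrows of \<open>Mod\<close> carry their endpoints; a functor determines these by its
  object map, so the only new information in \<open>amap F f\<close> is its \<open>mor\<close>
  part.\<close>

lemma functor_facts:
  assumes F: "is_functor J (Mod \<Sigma> T) F"
  shows functor_model: "i \<in> Obj J \<Longrightarrow> is_model \<Sigma> T (omap F i)"
    and functor_arrow: "f \<in> Arr J \<Longrightarrow>
      amap F f = Arrow (omap F (Dom J f)) (mor (amap F f)) (omap F (Cod J f))"
    and functor_morphism: "f \<in> Arr J \<Longrightarrow>
      is_morphism \<Sigma> (omap F (Dom J f)) (omap F (Cod J f)) (mor (amap F f))"
proof -
  show "is_model \<Sigma> T (omap F i)" if "i \<in> Obj J"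
    using F that by (auto simp: is_functor_def Mod_def)
  have "amap F f \<in> hom (Mod \<Sigma> T) (omap F (Dom J f)) (omap F (Cod J f))" if "f \<in> Arr J"
    using F that by (simp add: is_functor_def)
  then show "amap F f = Arrow (omap F (Dom J f)) (mor (amap F f)) (omap F (Cod J f))"
    and "is_morphism \<Sigma> (omap F (Dom J f)) (omap F (Cod J f)) (mor (amap F f))" if "f \<in> Arr J"
    using that by (auto simp: Mod_def hom_def)
qed

lemma fibre_of_functor:
  assumes "i \<in> Obj J"
  shows "fibre (of_functor F) i = omap F i"
  using assms by (auto simp: fibre_def of_functor_def)

lemma transition_of_functor:
  assumes F: "is_functor J (Mod \<Sigma> T) F" and f: "f \<in> Arr J"
  shows "transition J (of_functor F) f = mor (amap F f)"
proof (intro ext)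
  fix A a
  have "mor (amap F f) A \<in> carrier (omap F (Dom J f)) A \<rightarrow>\<^sub>E carrier (omap F (Cod J f)) A"
    using functor_morphism[OF F f] by (simp add: is_morphism_def)
  then show "transition J (of_functor F) f A a = mor (amap F f) A a"
    using f J.dom_obj by (auto simp: transition_def of_functor_def)
qed

text \<open>Once fibres and transitions are identified with the values of \<open>F\<close>, the
  conditions of \<open>diag_model_iff\<close> are the functor laws together with the fact that the
  values are models and morphisms.\<close>

lemma diag_model_of_functor:
  assumes F: "is_functor J (Mod \<Sigma> T) F"
  shows "diag_model (of_functor F)"
  unfolding diag_model_iff[OF J.category_axioms]
proof (intro conjI ballI allI impI)
  have strF: "is_structure \<Sigma> (omap F i)" if "i \<in> Obj J" for i
    using functor_model[OF F that] by (simp add: is_model_def)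
  have maps: "mor (amap F f) A a \<in> carrier (omap F (Cod J f)) A"
    if "f \<in> Arr J" "a \<in> carrier (omap F (Dom J f)) A" for f A a
    using functor_morphism[OF F that(1)] that(2) by (auto simp: is_morphism_def)
  have sort: "A \<in> Sorts \<Sigma>" if "i \<in> Obj J" "a \<in> carrier (omap F i) A" for i A a
    using strF[OF that(1)] that(2) by (auto simp: is_structure_def)
  show "is_structure (diag_sig \<Sigma> J) (of_functor F)"
    unfolding is_structure_def
  proof (intro conjI allI impI; (elim conjE)?)
    fix Ai assume "Ai \<notin> Sorts (diag_sig \<Sigma> J)"
    then show "carrier (of_functor F) Ai = {}"
      using sort by (auto simp: diag_sig_def of_functor_def split: if_splits)
  next
    fix s as b assume b: "interp (of_functor F) s as = Some b"
    have "s \<in> Funs (diag_sig \<Sigma> J) \<and>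
        list_all2 (\<lambda>a A. a \<in> carrier (of_functor F) A) as (arity (diag_sig \<Sigma> J) s) \<and>
        b \<in> carrier (of_functor F) (result (diag_sig \<Sigma> J) s)"
    proof (cases s)
      case (Lift g i)
      then have "i \<in> Obj J" "interp (omap F i) g as = Some b"
        using b by (auto simp: of_functor_def split: if_splits)
      then show ?thesis
        using structure_interp[OF strF] Lift
        by (auto simp: diag_sig_def of_functor_def list_all2_map2)
    next
      case (Alpha f A)
      then show ?thesis
        using b sort[OF J.dom_obj] maps J.dom_obj J.cod_obj
        by (auto simp: diag_sig_def of_functor_def split: if_splits)
    qed
    then show "s \<in> Funs (diag_sig \<Sigma> J)"
      "list_all2 (\<lambda>a A. a \<in> carrier (of_functor F) A) as (arity (diag_sig \<Sigma> J) s)"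
      "b \<in> carrier (of_functor F) (result (diag_sig \<Sigma> J) s)" by blast+
  qed
  show "satisfies (fibre (of_functor F) i) \<sigma>" if "i \<in> Obj J" "\<sigma> \<in> T" for i \<sigma>
    using functor_model[OF F] that by (simp add: fibre_of_functor is_model_def)
  show "interp (of_functor F) (Alpha f A) [a] = Some (transition J (of_functor F) f A a)"
    if "f \<in> Arr J" "a \<in> carrier (of_functor F) (A, Dom J f)" for f A a
    using that J.dom_obj by (simp add: transition_of_functor[OF F]) (simp add: of_functor_def)
  show "transition J (of_functor F) (Id J i) A a = a"
    if i: "i \<in> Obj J" and a: "a \<in> carrier (of_functor F) (A, i)" for i A a
  proof -
    have "Id J i \<in> Arr J" using J.id_hom[OF i] by (simp add: hom_def)
    moreover have "amap F (Id J i) = Id (Mod \<Sigma> T) (omap F i)"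
      using F i by (simp add: is_functor_def)
    ultimately show ?thesis
      using i a by (simp add: transition_of_functor[OF F] Mod_def) (simp add: of_functor_def)
  qed
  show "transition J (of_functor F) (Comp J g f) A a
      = transition J (of_functor F) g A (transition J (of_functor F) f A a)"
    if f: "f \<in> Arr J" and g: "g \<in> Arr J" and fg: "Cod J f = Dom J g"
      and a: "a \<in> carrier (of_functor F) (A, Dom J f)" for f g A a
  proof -
    have "Comp J g f \<in> Arr J"
      using J.comp_hom[of f "Dom J f" "Cod J f" g "Cod J g"] f g fg by (simp add: hom_def)
    moreover have "amap F (Comp J g f) = Comp (Mod \<Sigma> T) (amap F g) (amap F f)"
      using F f g fg by (simp add: is_functor_def)
    moreover have "src (amap F f) = omap F (Dom J f)"
      using functor_arrow[OF F f] arrow.sel(1) by metis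
    moreover have "a \<in> carrier (omap F (Dom J f)) A"
      using a f J.dom_obj by (simp add: of_functor_def)
    ultimately show ?thesis
      using f g by (simp add: transition_of_functor[OF F] Mod_def compose_eq)
  qed
  show "is_morphism \<Sigma> (fibre (of_functor F) (Dom J f)) (fibre (of_functor F) (Cod J f))
      (transition J (of_functor F) f)" if "f \<in> Arr J" for f
    using functor_morphism[OF F that] that J.dom_obj J.cod_obj
    by (simp add: fibre_of_functor transition_of_functor[OF F])
qed

lemma of_functor_to_functor:
  assumes M: "diag_model M"
  shows "of_functor (to_functor M) = M"
proof (rule pstruct.equality)
  note str = model_structure[OF M]
  show "carrier (of_functor (to_functor M)) = carrier M"
    using in_carrier_diag(2)[OF str] by (fastforce simp: of_functor_def to_functor_def fun_eq_iff)
  show "interp (of_functor (to_functor M)) = interp M"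
  proof (intro ext)
    fix s as
    show "interp (of_functor (to_functor M)) s as = interp M s as"
    proof (cases s)
      case (Lift g i)
      then show ?thesis
        using structure_interp(1)[OF str, of s as]
        by (cases "interp M s as") (auto simp: of_functor_def to_functor_def diag_sig_def)
    next
      case (Alpha f A)
      show ?thesis
      proof (cases "f \<in> Arr J \<and> (\<exists>a\<in>carrier M (A, Dom J f). as = [a])")
        case True
        then show ?thesis
          using Alpha interp_alpha[OF M] J.dom_obj by (auto simp: of_functor_def to_functor_def)
      next
        case False
        \<comment> \<open>Outside the guard of \<open>of_functor\<close> the model itself is
          undefined: a defined value would force \<open>f\<close> to be an arrow and
          \<open>as\<close> to be a single element of the source carrier.\<close>
        have "interp M s as = None"
        proof (rule ccontr)
          assume "interp M s as \<noteq> None"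
          then obtain b where b: "interp M s as = Some b" by blast
          show False
            using False structure_interp(1,2)[OF str b] Alpha
            by (auto simp: diag_sig_def list_all2_Cons2)
        qed
        then show ?thesis
          using False Alpha J.dom_obj by (auto simp: of_functor_def to_functor_def)
      qed
    qed
  qed
qed simp

lemma to_functor_of_functor:
  assumes F: "is_functor J (Mod \<Sigma> T) F"
  shows "to_functor (of_functor F) = F"
proof (rule functr.equality)
  have "omap F \<in> extensional (Obj J)" "amap F \<in> extensional (Arr J)"
    using F by (auto simp: is_functor_def PiE_def)
  note ext = extensionalityI[OF restrict_extensional this(1)]
    extensionalityI[OF restrict_extensional this(2)]
  show "omap (to_functor (of_functor F)) = omap F"
    unfolding to_functor_def functr.simps by (rule ext(1)) (simp add: fibre_of_functor)
  show "amap (to_functor (of_functor F)) = amap F"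
    unfolding to_functor_def functr.simps
    using functor_arrow[OF F] J.dom_obj J.cod_obj
    by (intro ext(2)) (simp add: fibre_of_functor transition_of_functor[OF F])
qed simp

subsection \<open>Morphisms as natural transformations\<close>

definition to_natural where
  "to_natural k = Arrow (to_functor (src k))
     (\<lambda>i\<in>Obj J. Arrow (fibre (src k) i) (\<lambda>A. mor k (A, i)) (fibre (tgt k) i)) (to_functor (tgt k))"

text \<open>The value \<open>\<lambda>_. undefined\<close> at non-objects is the one that
  \<open>diag_morphism_iff\<close> forces on every morphism, so the construction inverts
  \<open>to_natural\<close> exactly.\<close>

definition of_natural where
  "of_natural \<eta> = Arrow (of_functor (src \<eta>))
     (\<lambda>(A, i). if i \<in> Obj J then mor (mor \<eta> i) A else (\<lambda>_. undefined)) (of_functor (tgt \<eta>))"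

abbreviation diag_Mod ::
  "(('s \<times> 'o, ('s, 'f, 'o, 'm) diag_sym, 'u) pstruct,
    (('s \<times> 'o, ('s, 'f, 'o, 'm) diag_sym, 'u) pstruct, 's \<times> 'o \<Rightarrow> 'u \<Rightarrow> 'u) arrow) cat" where
  "diag_Mod \<equiv> Mod (diag_sig \<Sigma> J) (diag_theory \<Sigma> T J)"

lemma to_natural_in_Arr:
  assumes "k \<in> Arr diag_Mod"
  shows "to_natural k \<in> Arr (functor_category J (Mod \<Sigma> T))"
proof -
  obtain M h N where k: "k = Arrow M h N" and M: "diag_model M" and N: "diag_model N"
    and h: "is_morphism (diag_sig \<Sigma> J) M N h"
    using assms by (auto simp: Mod_def)
  note iff = diag_morphism_iff[OF M N, of h]
  let ?\<eta> = "\<lambda>i\<in>Obj J. Arrow (fibre M i) (\<lambda>A. h (A, i)) (fibre N i)"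
  have "?\<eta> \<in> (\<Pi>\<^sub>E i\<in>Obj J. hom (Mod \<Sigma> T) (omap (to_functor M) i) (omap (to_functor N) i))"
    using h iff model_fibre[OF M] model_fibre[OF N]
    by (auto simp: Mod_def hom_def to_functor_def)
  \<comment> \<open>Both composites have the same endpoints and are restricted to the same carrier,
    so their equality amounts to the element-wise square of
    \<open>diag_morphism_iff\<close>.\<close>
  moreover have "Comp (Mod \<Sigma> T) (amap (to_functor N) f) (?\<eta> (Dom J f))
      = Comp (Mod \<Sigma> T) (?\<eta> (Cod J f)) (amap (to_functor M) f)" if "f \<in> Arr J" for f
    using h iff that J.dom_obj J.cod_obj
    by (auto simp: Mod_def to_functor_def compose_def restrict_def fun_eq_iff)
  ultimately have "natural_transformation J (Mod \<Sigma> T) (to_functor M) (to_functor N) ?\<eta>"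
    using is_functor_to_functor[OF M] is_functor_to_functor[OF N]
    by (simp add: natural_transformation_def)
  then show ?thesis by (auto simp: k to_natural_def functor_category_def)
qed

lemma natural_component:
  assumes \<eta>: "natural_transformation J (Mod \<Sigma> T) F G \<eta>" and i: "i \<in> Obj J"
  shows "\<eta> i = Arrow (omap F i) (mor (\<eta> i)) (omap G i)"
    "is_morphism \<Sigma> (omap F i) (omap G i) (mor (\<eta> i))"
proof -
  have "\<eta> i \<in> hom (Mod \<Sigma> T) (omap F i) (omap G i)"
    using assms by (auto simp: natural_transformation_def)
  then show "\<eta> i = Arrow (omap F i) (mor (\<eta> i)) (omap G i)"
    "is_morphism \<Sigma> (omap F i) (omap G i) (mor (\<eta> i))"
    by (auto simp: Mod_def hom_def)
qed

lemma of_natural_in_Arr: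
  assumes "\<theta> \<in> Arr (functor_category J (Mod \<Sigma> T))"
  shows "of_natural \<theta> \<in> Arr diag_Mod"
proof -
  obtain F \<eta> G where \<theta>: "\<theta> = Arrow F \<eta> G" and \<eta>: "natural_transformation J (Mod \<Sigma> T) F G \<eta>"
    using assms by (auto simp: functor_category_def)
  have F: "is_functor J (Mod \<Sigma> T) F" and G: "is_functor J (Mod \<Sigma> T) G"
    using \<eta> by (auto simp: natural_transformation_def)
  let ?h = "\<lambda>(A, i). if i \<in> Obj J then mor (\<eta> i) A else (\<lambda>_. undefined)"
  have square: "mor (amap G f) A (mor (\<eta> (Dom J f)) A a)
      = mor (\<eta> (Cod J f)) A (mor (amap F f) A a)"
    if f: "f \<in> Arr J" and a: "a \<in> carrier (omap F (Dom J f)) A" for f A a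
  proof -
    \<comment> \<open>Naturality is evaluated at one element. Each composite is restricted to the
      carrier of the source of its first arrow, so both sources must be identified with
      \<open>omap F (Dom J f)\<close>.\<close>
    have "mor (Comp (Mod \<Sigma> T) (amap G f) (\<eta> (Dom J f))) A a
        = mor (Comp (Mod \<Sigma> T) (\<eta> (Cod J f)) (amap F f)) A a"
      using \<eta> f by (simp add: natural_transformation_def)
    moreover have "src (\<eta> (Dom J f)) = omap F (Dom J f)"
      using natural_component(1)[OF \<eta> J.dom_obj[OF f]] arrow.sel(1) by metis
    moreover have "src (amap F f) = omap F (Dom J f)"
      using functor_arrow[OF F f] arrow.sel(1) by metis
    ultimately show ?thesis using a by (simp add: Mod_def compose_eq)
  qed
  have "is_morphism (diag_sig \<Sigma> J) (of_functor F) (of_functor G) ?h"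
    unfolding diag_morphism_iff[OF diag_model_of_functor[OF F] diag_model_of_functor[OF G]]
  proof (intro conjI allI ballI impI)
    fix f A a assume f: "f \<in> Arr J" and a: "a \<in> carrier (of_functor F) (A, Dom J f)"
    then have "a \<in> carrier (omap F (Dom J f)) A"
      using J.dom_obj by (simp add: of_functor_def)
    then show "transition J (of_functor G) f A (?h (A, Dom J f) a)
        = ?h (A, Cod J f) (transition J (of_functor F) f A a)"
      using f square J.dom_obj J.cod_obj
      by (simp add: transition_of_functor[OF F] transition_of_functor[OF G])
  qed (simp_all add: fibre_of_functor natural_component(2)[OF \<eta>])
  then show ?thesis
    using diag_model_of_functor[OF F] diag_model_of_functor[OF G]
    by (simp add: \<theta> of_natural_def Mod_def cong: if_cong)
qed

lemma of_natural_to_natural: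
  assumes "k \<in> Arr diag_Mod"
  shows "of_natural (to_natural k) = k"
proof -
  obtain M h N where k: "k = Arrow M h N" and M: "diag_model M" and N: "diag_model N"
    and h: "is_morphism (diag_sig \<Sigma> J) M N h"
    using assms by (auto simp: Mod_def)
  \<comment> \<open>At non-objects this is the first conjunct of
    \<open>diag_morphism_iff\<close>.\<close>
  have "(\<lambda>(A, i). if i \<in> Obj J then h (A, i) else (\<lambda>_. undefined)) = h"
    using h diag_morphism_iff[OF M N] by auto
  then show ?thesis
    by (simp add: k to_natural_def of_natural_def of_functor_to_functor M N cong: if_cong)
qed

lemma to_natural_of_natural:
  assumes "\<theta> \<in> Arr (functor_category J (Mod \<Sigma> T))"
  shows "to_natural (of_natural \<theta>) = \<theta>"
proof -
  obtain F \<eta> G where \<theta>: "\<theta> = Arrow F \<eta> G" and \<eta>: "natural_transformation J (Mod \<Sigma> T) F G \<eta>"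
    using assms by (auto simp: functor_category_def)
  have F: "is_functor J (Mod \<Sigma> T) F" and G: "is_functor J (Mod \<Sigma> T) G"
    using \<eta> by (auto simp: natural_transformation_def)
  have "\<eta> \<in> extensional (Obj J)"
    using \<eta> by (auto simp: natural_transformation_def PiE_def)
  then have "(\<lambda>i\<in>Obj J. Arrow (fibre (of_functor F) i) (mor (\<eta> i)) (fibre (of_functor G) i)) = \<eta>"
    using natural_component(1)[OF \<eta>]
    by (intro extensionalityI[OF restrict_extensional]) (auto simp: fibre_of_functor)
  then show ?thesis
    by (simp add: \<theta> to_natural_def of_natural_def to_functor_of_functor F G cong: restrict_cong)
qed

section \<open>Assembling the isomorphism\<close>

lemma isomorphic_diag_Mod:
  "isomorphic_categories
    (diag_Mod :: (('s \<times> 'o, ('s, 'f, 'o, 'm) diag_sym, 'u) pstruct,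
      (('s \<times> 'o, ('s, 'f, 'o, 'm) diag_sym, 'u) pstruct, 's \<times> 'o \<Rightarrow> 'u \<Rightarrow> 'u) arrow) cat)
    (functor_category J (Mod \<Sigma> T
      :: (('s, 'f, 'u) pstruct, (('s, 'f, 'u) pstruct, 's \<Rightarrow> 'u \<Rightarrow> 'u) arrow) cat))"
  (is "isomorphic_categories ?C ?D")
proof -
  \<comment> \<open>Functors are required to be extensional, hence the restrictions.\<close>
  let ?F = "\<lparr>omap = restrict to_functor (Obj ?C), amap = restrict to_natural (Arr ?C)\<rparr>"
  interpret C: category ?C by (rule category_Mod)
  have obj: "to_functor M \<in> Obj ?D" if "M \<in> Obj ?C" for M
    using is_functor_to_functor that by (simp add: Mod_def functor_category_def)
  have "is_functor ?C ?D ?F"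
    unfolding is_functor_def
  proof (intro conjI ballI impI)
    show "category ?C" "category ?D"
      by (simp_all add: category_Mod category_functor_category J.category_axioms)
    show "omap ?F \<in> Obj ?C \<rightarrow>\<^sub>E Obj ?D" "amap ?F \<in> Arr ?C \<rightarrow>\<^sub>E Arr ?D"
      using obj to_natural_in_Arr by auto
  next
    fix k assume k: "k \<in> Arr ?C"
    then show "amap ?F k \<in> hom ?D (omap ?F (Dom ?C k)) (omap ?F (Cod ?C k))"
      using to_natural_in_Arr[OF k] C.dom_obj C.cod_obj
      by (simp add: hom_def) (simp add: functor_category_def to_natural_def Mod_def)
  next
    fix M assume M: "M \<in> Obj ?C"
    then have "Id ?C M \<in> Arr ?C" using C.id_hom by (simp add: hom_def)
    then show "amap ?F (Id ?C M) = Id ?D (omap ?F M)"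
      using M by (simp add: functor_category_def to_natural_def Mod_def to_functor_def
          cong: restrict_cong)
  next
    fix k l assume kl: "k \<in> Arr ?C" "l \<in> Arr ?C" "Cod ?C k = Dom ?C l"
    then have "Comp ?C l k \<in> Arr ?C"
      using C.comp_hom[of k "Dom ?C k" "Cod ?C k" l "Cod ?C l"] by (simp add: hom_def)
    \<comment> \<open>Composition is computed sort by sort in \<open>Mod\<close> and object by
      object in the functor category, so slicing a composite at \<open>i\<close> gives the composite
      of the slices by unfolding.\<close>
    then show "amap ?F (Comp ?C l k) = Comp ?D (amap ?F l) (amap ?F k)"
      using kl by (simp add: functor_category_def to_natural_def Mod_def cong: restrict_cong)
  qed
  moreover have "bij_betw to_functor (Obj ?C) (Obj ?D)"
    using of_functor_to_functor to_functor_of_functor obj diag_model_of_functor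
    by (intro bij_betw_byWitness[where f' = of_functor])
      (auto simp: Mod_def functor_category_def)
  then have "bij_betw (omap ?F) (Obj ?C) (Obj ?D)" by simp
  moreover have "bij_betw to_natural (Arr ?C) (Arr ?D)"
    using of_natural_to_natural to_natural_of_natural to_natural_in_Arr of_natural_in_Arr
    by (intro bij_betw_byWitness[where f' = of_natural]) blast+
  then have "bij_betw (amap ?F) (Arr ?C) (Arr ?D)" by simp
  ultimately show ?thesis by (rule isomorphic_categories_if_bij)
qed

end

theorem proposition3p8:
  fixes \<Sigma> :: "('s, 'f) signature"
    and T :: "('s, 'f) sequent set"
    and J :: "('o, 'm) cat"
  assumes "is_signature \<Sigma>"
    and "is_theory \<Sigma> T"
    and "category J"
  shows "isomorphic_categories
    (Mod (diag_sig \<Sigma> J) (diag_theory \<Sigma> T J)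
      :: (('s \<times> 'o, ('s, 'f, 'o, 'm) diag_sym, 'u) pstruct,
          (('s \<times> 'o, ('s, 'f, 'o, 'm) diag_sym, 'u) pstruct, 's \<times> 'o \<Rightarrow> 'u \<Rightarrow> 'u) arrow) cat)
    (functor_category J
      (Mod \<Sigma> T
        :: (('s, 'f, 'u) pstruct, (('s, 'f, 'u) pstruct, 's \<Rightarrow> 'u \<Rightarrow> 'u) arrow) cat))"
proof -
  interpret diagram_theory \<Sigma> T J
    using assms by (simp add: diagram_theory_def)
  show ?thesis by (rule isomorphic_diag_Mod)
qed

end
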